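(* Let $n,r$ be positive integers, $K_r=2^{2r}-2^r+1$, and $a,s\in\{1,\dots,2^n-2\}$ with binary expansions $a=\sum_{i=0}^{n-1}a_i2^i$ and $s=\sum_{i=0}^{n-1}s_i2^i$. The following are equivalent: (a) $s\equiv K_r\cdot a\pmod{2^n-1}$; (b) there exists a sequence $(c_{n-1},\dots,c_0)$ with $c_i\in\{-1,0,1\}$ such that $2c_i-c_{i-1}+s_i=a_{i-2r}-a_{i-r}+a_i$ for all $i$, where indices are taken modulo $n$. Moreover, the sequence $c$ in (b) is unique. *)

theory Defs
  imports Main "HOL-Library.FuncSet" "HOL-Number_Theory.Cong"
begin

definition K :: "nat \<Rightarrow> int"
  where "K r = 2 ^ (2 * r) - 2 ^ r + 1"

definition binary_expansion :: "nat \<Rightarrow> int \<Rightarrow> (nat \<Rightarrow> int) \<Rightarrow> bool"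
  where "binary_expansion n x d \<longleftrightarrow> (\<forall>i<n. d i \<in> {0, 1}) \<and> x = (\<Sum>i<n. d i * 2 ^ i)"

text \<open>The entry of a length-\<open>n\<close> sequence at an arbitrary integer index, read modulo \<open>n\<close>.\<close>

definition cyc :: "nat \<Rightarrow> (nat \<Rightarrow> int) \<Rightarrow> int \<Rightarrow> int"
  where "cyc n x k = x (nat (k mod int n))"

text \<open>Sequences of length \<open>n\<close> are extensional functions on \<open>{..<n}\<close>, so that equality of
  functions is equality of sequences. Here \<open>ad\<close> and \<open>sd\<close> are the sequences of binary digits
  of \<open>a\<close> and \<open>s\<close>.\<close>

definition carry_sequence ::
    "nat \<Rightarrow> nat \<Rightarrow> (nat \<Rightarrow> int) \<Rightarrow> (nat \<Rightarrow> int) \<Rightarrow> (nat \<Rightarrow> int) \<Rightarrow> bool"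
  where "carry_sequence n r ad sd c \<longleftrightarrow>
    c \<in> {..<n} \<rightarrow>\<^sub>E {-1, 0, 1} \<and>
    (\<forall>i<n. 2 * cyc n c (int i) - cyc n c (int i - 1) + cyc n sd (int i)
         = cyc n ad (int i - 2 * int r) - cyc n ad (int i - int r) + cyc n ad (int i))"

end

theory Submission
  imports Defs
begin

text \<open>
  For an \<open>n\<close>-periodic integer sequence \<open>f\<close>, the value \<open>R(k) = \<Sum>j<n. f (k + j) 2^j\<close> of its
  rotation by \<open>k\<close> satisfies \<open>2 R(k + 1) = R(k) + (2^n - 1) f(k)\<close>. Hence rotating the digits
  multiplies the value by a power of \<open>2\<close> modulo \<open>2^n - 1\<close>. With \<open>d\<close> the difference of
  the right-hand side of the carry equations and the digits of \<open>s\<close>, condition (a) says that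
  \<open>2^n - 1\<close> divides \<open>R(0)\<close>, hence every \<open>R(k)\<close>, and then \<open>c\<^sub>i = R(i + 1) / (2^n - 1)\<close> solves the
  equations. Since \<open>\<bar>d\<^sub>i\<bar> \<le> 2\<close>, and neither bound can be attained at every \<open>i\<close> because \<open>s\<close> has a
  digit \<open>0\<close> and a digit \<open>1\<close>, these \<open>c\<^sub>i\<close> lie in \<open>{-1, 0, 1}\<close>.
\<close>

section \<open>Rotations of periodic sequences and their binary values\<close>

definition periodic :: "nat \<Rightarrow> (int \<Rightarrow> int) \<Rightarrow> bool"
  where "periodic n f \<longleftrightarrow> (\<forall>k. f (k mod int n) = f k)"

definition rot_val :: "nat \<Rightarrow> (int \<Rightarrow> int) \<Rightarrow> int \<Rightarrow> int"
  where "rot_val n f k = (\<Sum>j<n. f (k + int j) * 2 ^ j)"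

lemma periodic_cyc: "periodic n (cyc n x)"
  by (simp add: periodic_def cyc_def)

lemma cyc_of_nat: "i < n \<Longrightarrow> cyc n x (int i) = x i"
  by (simp add: cyc_def)

lemma periodic_shift:
  assumes "periodic n f"
  shows "periodic n (\<lambda>k. f (k + m))"
proof -
  have "f (k mod int n + m) = f (k + m)" for k
    using assms unfolding periodic_def by (metis mod_add_left_eq)
  then show ?thesis by (simp add: periodic_def)
qed

lemma periodic_diff:
  assumes "periodic n f" "periodic n g"
  shows "periodic n (\<lambda>k. f k - g k)"
  using assms by (simp add: periodic_def)

lemma periodic_add_period:
  assumes "periodic n f"
  shows "f (k + int n) = f k"
  using assms by (metis mod_add_self2 periodic_def)

lemma rot_val_diff: "rot_val n (\<lambda>k. f k - g k) k = rot_val n f k - rot_val n g k"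
  by (simp add: rot_val_def sum_subtractf left_diff_distrib)

lemma rot_val_add: "rot_val n (\<lambda>k. f k + g k) k = rot_val n f k + rot_val n g k"
  by (simp add: rot_val_def sum.distrib distrib_right)

lemma rot_val_mult: "rot_val n (\<lambda>k. m * f k) k = m * rot_val n f k"
  by (simp add: rot_val_def sum_distrib_left mult.assoc)

lemma rot_val_shift: "rot_val n (\<lambda>k. f (k + m)) k = rot_val n f (k + m)"
  by (simp add: rot_val_def add_ac)

lemma periodic_rot_val:
  assumes "periodic n f"
  shows "periodic n (rot_val n f)"
proof -
  have "f (k mod int n + int j) = f (k + int j)" for k j
    using periodic_shift[OF assms, of "int j"] by (simp only: periodic_def)
  then show ?thesis by (simp add: periodic_def rot_val_def)
qed

lemma rot_val_cyc_0: "binary_expansion n x d \<Longrightarrow> rot_val n (cyc n d) 0 = x"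
  by (simp add: rot_val_def binary_expansion_def cyc_of_nat)

text \<open>Doubling raises every weight by one place: the window then lacks its bottom term
  \<open>f k\<close> and gains a top term of weight \<open>2 ^ n\<close>, which periodicity turns
  into \<open>f k\<close> again.\<close>

lemma rot_val_Suc:
  assumes "periodic n f"
  shows "2 * rot_val n f (k + 1) = rot_val n f k + (2 ^ n - 1) * f k"
proof -
  have "2 * rot_val n f (k + 1) = (\<Sum>j<n. f (k + int (Suc j)) * 2 ^ Suc j)"
    by (simp add: rot_val_def sum_distrib_left mult_ac add_ac)
  also have "\<dots> = (\<Sum>j<Suc n. f (k + int j) * 2 ^ j) - f k"
    by (subst sum.lessThan_Suc_shift) simp
  also have "\<dots> = rot_val n f k + (2 ^ n - 1) * f k"
    using periodic_add_period[OF assms, of k] by (simp add: rot_val_def algebra_simps)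
  finally show ?thesis .
qed

text \<open>Each step back by one index doubles the value modulo \<open>2 ^ n - 1\<close>. Going
  backwards fits the indices \<open>i - r\<close> and \<open>i - 2 * r\<close> and avoids inverting
  \<open>2\<close>.\<close>

lemma rot_val_cong:
  assumes "periodic n f"
  shows "[rot_val n f (k - int m) = 2 ^ m * rot_val n f k] (mod (2 ^ n - 1))"
proof (induction m)
  case (Suc m)
  have "2 * rot_val n f (k - int m)
      = rot_val n f (k - int (Suc m)) + (2 ^ n - 1) * f (k - int (Suc m))"
    using rot_val_Suc[OF assms, of "k - int (Suc m)"] by simp
  then have "[rot_val n f (k - int (Suc m)) = 2 * rot_val n f (k - int m)] (mod (2 ^ n - 1))"
    by (simp add: cong_iff_dvd_diff)
  also have "[2 * rot_val n f (k - int m) = 2 * (2 ^ m * rot_val n f k)] (mod (2 ^ n - 1))"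
    using Suc.IH by (rule cong_scalar_left)
  finally show ?case by (simp add: mult.assoc)
qed simp

text \<open>Every window of length \<open>n\<close> meets the residue class of \<open>m\<close>, so
  one strict inequality affects all rotations at once.\<close>

lemma rot_val_strict_mono:
  assumes "periodic n f" "periodic n g" "n > 0" "\<And>i. f i \<le> g i" "f m < g m"
  shows "rot_val n f k < rot_val n g k"
  unfolding rot_val_def
proof (rule sum_strict_mono_ex1)
  define j where "j = nat ((m - k) mod int n)"
  have j: "j < n" "int j = (m - k) mod int n"
    using assms(3) by (simp_all add: j_def nat_less_iff)
  have "(k + int j) mod int n = m mod int n"
    by (simp add: j mod_add_right_eq)
  then have "f (k + int j) < g (k + int j)"
    using assms(1,2,5) by (metis periodic_def)
  then show "\<exists>j\<in>{..<n}. f (k + int j) * 2 ^ j < g (k + int j) * 2 ^ j"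
    using j(1) by auto
qed (use assms(4) in auto)

lemma rot_val_const: "rot_val n (\<lambda>_. m) k = m * (2 ^ n - 1)"
proof -
  have "(\<Sum>j<n. 2 ^ j) = (2 ^ n - 1 :: int)"
    by (induction n) auto
  then show ?thesis
    by (simp add: rot_val_def flip: sum_distrib_left)
qed

section \<open>The carry recursion and uniqueness of its solution\<close>

text \<open>Weighting the equations by \<open>2 ^ i\<close> and summing leaves
  \<open>2 * R(0) - R(-1)\<close> for the values \<open>R\<close> of \<open>C\<close>, which
  \<open>rot_val_Suc\<close> evaluates. This serves both uniqueness, with \<open>d = 0\<close>, and
  the step from (b) to (a).\<close>

lemma rot_val_carry:
  assumes "periodic n C"
    and "\<And>i. i < n \<Longrightarrow> 2 * C (int i) - C (int i - 1) = d (int i)"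
  shows "rot_val n d 0 = (2 ^ n - 1) * C (- 1)"
proof -
  have "rot_val n d 0 = rot_val n (\<lambda>k. 2 * C k - C (k + - 1)) 0"
    using assms(2) by (simp add: rot_val_def)
  also have "\<dots> = 2 * rot_val n C 0 - rot_val n C (- 1)"
    using rot_val_shift[of n C "-1" 0] by (simp add: rot_val_diff rot_val_mult)
  finally show ?thesis
    using rot_val_Suc[OF assms(1), of "- 1"] by simp
qed

text \<open>The weighted sum forces \<open>E (- 1) = 0\<close>; the recursion then carries the zero
  upwards from index \<open>0\<close>. Applied to the difference of two carry sequences, this gives
  uniqueness.\<close>

lemma carry_zero:
  assumes "periodic n E" "n > 1"
    and "\<And>i. i < n \<Longrightarrow> 2 * E (int i) - E (int i - 1) = 0" "i < n"
  shows "E (int i) = 0"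
proof -
  have "(2 ^ n - 1) * E (- 1) = 0"
    using rot_val_carry[of n E "\<lambda>_. 0"] assms rot_val_const[of n 0] by simp
  moreover have "(2 :: int) ^ n > 1"
    using assms(2) by simp
  ultimately have *: "E (- 1) = 0"
    using assms(2) by simp
  show ?thesis using \<open>i < n\<close>
  proof (induction i)
    case 0
    then show ?case using assms(3)[of 0] * by simp
  next
    case (Suc i)
    then show ?case using assms(3)[of "Suc i"] by simp
  qed
qed

lemma carry_sequence_unique:
  assumes "n > 1" "carry_sequence n r ad sd c" "carry_sequence n r ad sd c'"
  shows "c = c'"
proof (rule PiE_ext)
  show "c \<in> {..<n} \<rightarrow>\<^sub>E {- 1, 0, 1}" "c' \<in> {..<n} \<rightarrow>\<^sub>E {- 1, 0, 1}"
    using assms(2,3) by (simp_all add: carry_sequence_def)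
next
  fix i assume "i \<in> {..<n}"
  then have "i < n" by simp
  have "cyc n c (int i) - cyc n c' (int i) = 0"
  proof (rule carry_zero[OF _ assms(1) _ \<open>i < n\<close>])
    show "periodic n (\<lambda>k. cyc n c k - cyc n c' k)"
      by (intro periodic_diff periodic_cyc)
  next
    fix j assume "j < n"
    then have "2 * cyc n c (int j) - cyc n c (int j - 1)
        = 2 * cyc n c' (int j) - cyc n c' (int j - 1)"
      using assms(2,3) unfolding carry_sequence_def by (metis add_right_cancel)
    then show "2 * (cyc n c (int j) - cyc n c' (int j))
        - (cyc n c (int j - 1) - cyc n c' (int j - 1)) = 0"
      by simp
  qed
  then show "c i = c' i"
    using \<open>i < n\<close> by (simp add: cyc_of_nat)
qed

section \<open>Condition (a) as a divisibility\<close>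

text \<open>The shifts are written \<open>k + - m\<close> so that they match the form
  \<open>k + m\<close> in \<open>periodic_shift\<close> and \<open>rot_val_shift\<close>.\<close>

definition carry_diff :: "nat \<Rightarrow> nat \<Rightarrow> (nat \<Rightarrow> int) \<Rightarrow> (nat \<Rightarrow> int) \<Rightarrow> int \<Rightarrow> int"
  where "carry_diff n r ad sd k
    = cyc n ad (k + - int (2 * r)) - cyc n ad (k + - int r) + cyc n ad k - cyc n sd k"

lemma periodic_carry_diff: "periodic n (carry_diff n r ad sd)"
proof -
  have "cyc n ad (k mod int n + m) = cyc n ad (k + m)" for k m
    using periodic_shift[OF periodic_cyc] by (simp only: periodic_def)
  then show ?thesis
    using periodic_cyc[of n ad] periodic_cyc[of n sd]
    by (simp add: periodic_def carry_diff_def del: add_uminus_conv_diff)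
qed

text \<open>The digits of \<open>a\<close> shifted by \<open>2 * r\<close>, \<open>r\<close> and
  \<open>0\<close> contribute the factors \<open>2 ^ (2 * r)\<close>, \<open>2 ^ r\<close> and
  \<open>1\<close>, whose signed sum is \<open>K r\<close>.\<close>

lemma rot_val_carry_diff_cong:
  assumes "binary_expansion n a ad" "binary_expansion n s sd"
  shows "[rot_val n (carry_diff n r ad sd) 0 = K r * a - s] (mod (2 ^ n - 1))"
proof -
  let ?A = "cyc n ad"
  have cong: "[rot_val n ?A (- int m) = 2 ^ m * a] (mod (2 ^ n - 1))" for m
    using rot_val_cong[OF periodic_cyc, of n ad 0 m] rot_val_cyc_0[OF assms(1)] by simp
  have "rot_val n (carry_diff n r ad sd) 0
      = rot_val n ?A (- int (2 * r)) - rot_val n ?A (- int r) + a - s"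
    unfolding carry_diff_def rot_val_diff rot_val_add
    by (simp add: rot_val_shift[of n ?A] rot_val_cyc_0[OF assms(1)] rot_val_cyc_0[OF assms(2)]
        del: of_nat_mult add_uminus_conv_diff)
  also have "[\<dots> = 2 ^ (2 * r) * a - 2 ^ r * a + a - s] (mod (2 ^ n - 1))"
    by (intro cong_diff cong_add cong cong_refl)
  finally show ?thesis by (simp add: K_def algebra_simps)
qed

lemma cong_iff_dvd_rot_val:
  assumes "binary_expansion n a ad" "binary_expansion n s sd"
  shows "[s = K r * a] (mod (2 ^ n - 1))
    \<longleftrightarrow> 2 ^ n - 1 dvd rot_val n (carry_diff n r ad sd) 0"
  using cong_dvd_iff[OF cong_sym[OF rot_val_carry_diff_cong[OF assms, of r]]]
    rot_val_carry_diff_cong[OF assms, of r]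
  by (metis cong_dvd_iff cong_iff_dvd_diff cong_sym_eq)

section \<open>Existence of a carry sequence with entries in \<open>{-1, 0, 1}\<close>\<close>

lemma cyc_binary:
  assumes "n > 0" "binary_expansion n x d"
  shows "cyc n d k \<in> {0, 1}"
  using assms by (simp add: cyc_def binary_expansion_def nat_less_iff)

text \<open>Constant digits \<open>0\<close> or \<open>1\<close> would give the value
  \<open>0\<close> or \<open>2 ^ n - 1\<close>, both outside the range of \<open>x\<close>.\<close>

lemma binary_expansion_exists_digit:
  assumes "n > 0" "binary_expansion n x d" "x \<in> {1..2 ^ n - 2}"
  shows "\<exists>k. cyc n d k = 1" "\<exists>k. cyc n d k = 0"
proof -
  have "cyc n d = (\<lambda>_. 0) \<Longrightarrow> False"
    using rot_val_cyc_0[OF assms(2)] rot_val_const[of n 0 0] assms(3) by simp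
  then show "\<exists>k. cyc n d k = 1"
    using cyc_binary[OF assms(1,2)] by fastforce
  have "cyc n d = (\<lambda>_. 1) \<Longrightarrow> False"
    using rot_val_cyc_0[OF assms(2)] rot_val_const[of n 1 0] assms(3) by simp
  then show "\<exists>k. cyc n d k = 0"
    using cyc_binary[OF assms(1,2)] by fastforce
qed

lemma carry_sequence_exists:
  assumes "n > 1" "binary_expansion n a ad" "binary_expansion n s sd" "s \<in> {1..2 ^ n - 2}"
    and dvd: "2 ^ n - 1 dvd rot_val n (carry_diff n r ad sd) 0"
  shows "\<exists>c. carry_sequence n r ad sd c"
proof -
  define N :: int where "N = 2 ^ n - 1"
  define d where "d = carry_diff n r ad sd"
  \<comment> \<open>The offset \<open>k + 1\<close> makes \<open>rot_val_Suc\<close>, divided by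
    \<open>N\<close>, read \<open>2 * C k = C (k - 1) + d k\<close>.\<close>
  define C where "C k = rot_val n d (k + 1) div N" for k
  define c where "c = restrict (\<lambda>i. C (int i)) {..<n}"
  have n: "n > 0" using assms(1) by simp
  have "(2 :: int) ^ n > 1" using assms(1) by simp
  then have N: "N > 0" by (simp add: N_def)
  have d: "periodic n d"
    by (simp add: d_def periodic_carry_diff)
  have C: "periodic n C"
    using periodic_shift[OF periodic_rot_val[OF d], of 1] by (simp add: periodic_def C_def)
  \<comment> \<open>Modulo \<open>n\<close> every index equals some \<open>- int m\<close>, and
    there the value is a power of \<open>2\<close> times the one at \<open>0\<close>.\<close>
  have dvd_all: "N dvd rot_val n d k" for k
  proof -
    define m where "m = nat (- k mod int n)"
    have m: "int m = - k mod int n"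
      using n by (simp add: m_def)
    have "(- int m) mod int n = k mod int n"
      by (simp add: m mod_minus_eq)
    then have "rot_val n d k = rot_val n d (0 - int m)"
      using periodic_rot_val[OF d] by (metis diff_0 periodic_def)
    also have "N dvd \<dots>"
      using rot_val_cong[OF d, of 0 m] dvd
      by (simp add: cong_dvd_iff N_def d_def)
    finally show ?thesis .
  qed
  have NC: "N * C k = rot_val n d (k + 1)" for k
    using dvd_all by (simp add: C_def)
  have carry: "2 * C k - C (k - 1) = d k" for k
  proof -
    have "N * (2 * C k - C (k - 1)) = N * d k"
      using rot_val_Suc[OF d, of k] NC[of k] NC[of "k - 1"]
      by (simp add: N_def algebra_simps)
    then show ?thesis using N by simp
  qed
  have A: "cyc n ad k \<in> {0, 1}" and S: "cyc n sd k \<in> {0, 1}" for k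
    using cyc_binary[OF n] assms(2,3) by auto
  \<comment> \<open>The digit of \<open>s\<close> stays in the bounds: where it is \<open>1\<close>
    the upper bound \<open>2\<close> is missed, where it is \<open>0\<close> the lower bound
    \<open>- 2\<close> is missed.\<close>
  have bounds: "d k \<le> 2 - cyc n sd k" "- 1 - cyc n sd k \<le> d k" for k
    using A[of k] A[of "k + - int (2 * r)"] A[of "k + - int r"]
    by (auto simp: d_def carry_diff_def)
  have const: "periodic n (\<lambda>_. m)" for m
    by (simp add: periodic_def)
  obtain k1 k0 where k1: "cyc n sd k1 = 1" and k0: "cyc n sd k0 = 0"
    using binary_expansion_exists_digit[OF n assms(3,4)] by blast
  have upper: "C k < 2" for k
  proof -
    have "d i \<le> 2" for i using bounds(1)[of i] S[of i] by auto
    moreover have "d k1 < 2" using bounds(1)[of k1] k1 by simp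
    \<comment> \<open>The comparison is with the constant sequence \<open>2\<close>, whose value is
      \<open>2 * N\<close>.\<close>
    ultimately have "N * C k < N * 2"
      using rot_val_strict_mono[OF d const n, of 2 k1 "k + 1"]
      by (simp add: NC rot_val_const flip: N_def)
    then show ?thesis using N by simp
  qed
  have lower: "- 2 < C k" for k
  proof -
    have "- 2 \<le> d i" for i using bounds(2)[of i] S[of i] by auto
    moreover have "- 2 < d k0" using bounds(2)[of k0] k0 by simp
    ultimately have "N * (- 2) < N * C k"
      using rot_val_strict_mono[OF const d n, of "- 2" k0 "k + 1"]
      by (simp add: NC rot_val_const flip: N_def)
    then show ?thesis using N by (simp only: mult_less_cancel_left_pos)
  qed
  have "C k \<in> {- 1, 0, 1}" for k
    using upper[of k] lower[of k] by auto
  then have "c \<in> {..<n} \<rightarrow>\<^sub>E {- 1, 0, 1}"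
    by (auto simp: c_def)
  moreover have "cyc n c k = C k" for k
    using C n by (simp add: cyc_def c_def nat_less_iff periodic_def)
  ultimately have "carry_sequence n r ad sd c"
    using carry by (simp add: carry_sequence_def d_def carry_diff_def)
  then show ?thesis by blast
qed

theorem theorem5:
  fixes n r :: nat and a s :: int and ad sd :: "nat \<Rightarrow> int"
  assumes "n > 0" and "r > 0"
    and "a \<in> {1..2 ^ n - 2}" and "s \<in> {1..2 ^ n - 2}"
    and "binary_expansion n a ad" and "binary_expansion n s sd"
  shows "([s = K r * a] (mod (2 ^ n - 1)) \<longleftrightarrow> (\<exists>c. carry_sequence n r ad sd c))
    \<and> (\<forall>c c'. carry_sequence n r ad sd c \<longrightarrow> carry_sequence n r ad sd c' \<longrightarrow> c = c')"
proof -
  \<comment> \<open>For \<open>n = 1\<close> the range of \<open>s\<close> is empty.\<close>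
  have "n \<noteq> 1" using assms(4) by auto
  then have n: "n > 1" using assms(1) by simp
  have "2 ^ n - 1 dvd rot_val n (carry_diff n r ad sd) 0" if c: "carry_sequence n r ad sd c" for c
  proof -
    have "rot_val n (carry_diff n r ad sd) 0 = (2 ^ n - 1) * cyc n c (- 1)"
    proof (rule rot_val_carry[OF periodic_cyc])
      fix i assume "i < n"
      then show "2 * cyc n c (int i) - cyc n c (int i - 1) = carry_diff n r ad sd (int i)"
        using c by (auto simp: carry_sequence_def carry_diff_def algebra_simps)
    qed
    then show ?thesis by simp
  qed
  then show ?thesis
    using carry_sequence_exists[OF n assms(5,6,4)] carry_sequence_unique[OF n]
    unfolding cong_iff_dvd_rot_val[OF assms(5,6)] by blast
qed

end
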